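(* Let $\Omega^+\subseteq\mathbb{R}^2$ be a Jordan domain, let $\Omega^-:=\mathbb{R}^2\setminus\overline{\Omega^+}$, and let $\Gamma:=\partial\Omega^{\pm}$. Fix $\alpha\in(0,1)$ and $C_0>0$. Suppose there exists $r_0>0$ such that $$\varepsilon(x,r)\le C_0 r^{\alpha}\qquad\text{for all } x\in\Gamma,\ r\le r_0 .$$ Then there exist $0<\rho_1\le r_0$ and a constant $C>0$ (independent of $x_0$ and $r$ below) so that $$\beta(x_0,r)\le C r^{\alpha/16}\qquad\text{for all } x_0\in\Gamma\text{ and } 0<r\le\rho_1 .$$
   Context: A Jordan domain is a domain in $\mathbb{R}^2$ whose boundary is a Jordan curve. For $x\in\Gamma$ and $r>0$, $I^{\pm}(x,r)$ denotes the largest (with respect to $\mathcal{H}^1$-measure) open arc of the circumference $\partial B(x,r)$ contained in $\Omega^{\pm}$. The Carleson $\varepsilon$-function is $$\varepsilon(x,r)=\frac1r\max\left\{|\pi r-\mathcal{H}^1(I^+(x,r))|,\ |\pi r-\mathcal{H}^1(I^-(x,r))|\right\}.$$ The Jones $\beta$-numbers of $\Gamma$ are, for $x\in\Gamma$ and $r>0$, $$\beta(x,r)=\frac1r\inf_{L:\,L\cap B(x,r)\ne\emptyset}\ \sup_{y\in\Gamma\cap B(x,r)} d(y,L),$$ the infimum being over affine lines $L\subset\mathbb{R}^2$ meeting $B(x,r)$. *)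

theory Defs
  imports "HOL-Analysis.Analysis"
begin

text \<open>The plane is the type \<^typ>\<open>complex\<close> with its Euclidean metric.\<close>

definition jordan_curve :: "complex set \<Rightarrow> bool" where
  "jordan_curve J \<longleftrightarrow>
     (\<exists>c. simple_path c \<and> pathfinish c = pathstart c \<and> path_image c = J)"

definition jordan_domain :: "complex set \<Rightarrow> bool" where
  "jordan_domain D \<longleftrightarrow>
     D \<noteq> {} \<and> open D \<and> connected D \<and> jordan_curve (frontier D)"

text \<open>
  One-dimensional Hausdorff (outer) measure, normalised so that it is the length on line segments.
  Boundedness of the covering sets is required because \<^const>\<open>diameter\<close> is a real number,
  unspecified for unbounded sets.
\<close>

definition hausdorff1_delta :: "real \<Rightarrow> 'a::metric_space set \<Rightarrow> ennreal" where
  "hausdorff1_delta \<delta> A =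
     (INF U \<in> {U :: nat \<Rightarrow> 'a set. A \<subseteq> (\<Union>i. U i) \<and> (\<forall>i. bounded (U i) \<and> diameter (U i) \<le> \<delta>)}.
        \<Sum>i. ennreal (diameter (U i)))"

definition hausdorff1 :: "'a::metric_space set \<Rightarrow> ennreal" where
  "hausdorff1 A = (SUP \<delta> \<in> {0<..}. hausdorff1_delta \<delta> A)"

text \<open>
  The empty arc (\<open>a = b\<close>) is admitted, so that a largest arc inside \<open>D\<close> exists even if the
  circle does not meet \<open>D\<close>. The largest arc need not be unique, but its measure is. If the whole
  circle lies in \<open>D\<close>, the largest arc is the circle minus a point, which has full measure.
\<close>

definition open_circle_arc :: "complex \<Rightarrow> real \<Rightarrow> complex set \<Rightarrow> bool" where
  "open_circle_arc x r A \<longleftrightarrow>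
     (\<exists>a b. a \<le> b \<and> b \<le> a + 2 * pi \<and> A = (\<lambda>t. x + rcis r t) ` {a<..<b})"

definition largest_arc :: "complex set \<Rightarrow> complex \<Rightarrow> real \<Rightarrow> complex set" where
  "largest_arc D x r = (ARG_MAX hausdorff1 A. open_circle_arc x r A \<and> A \<subseteq> D)"

definition carleson_eps :: "complex set \<Rightarrow> complex set \<Rightarrow> complex \<Rightarrow> real \<Rightarrow> real" where
  "carleson_eps Dp Dm x r =
     1 / r * max \<bar>pi * r - enn2real (hausdorff1 (largest_arc Dp x r))\<bar>
                 \<bar>pi * r - enn2real (hausdorff1 (largest_arc Dm x r))\<bar>"

definition jones_beta :: "complex set \<Rightarrow> complex \<Rightarrow> real \<Rightarrow> real" where
  "jones_beta G x r =
     1 / r * (INF L \<in> {L. affine L \<and> aff_dim L = 1 \<and> L \<inter> ball x r \<noteq> {}}.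
                SUP y \<in> G \<inter> ball x r. infdist y L)"

end

theory Submission
  imports Defs
begin

text \<open>
  A bound \<open>\<delta>\<close> on the Carleson function at \<open>x\<close> and \<open>r\<close> forces the two large arcs to leave only two
  short gaps in the circle, which are nearly antipodal, and the boundary meets both gaps
  (\<open>frontier_on_circle_antipodal_clusters\<close>). So, up to an error proportional to \<open>\<delta> * r\<close>, two points
  of \<open>\<Gamma>\<close> at equal distance from a third point of \<open>\<Gamma>\<close> either coincide or are antipodal about it,
  and every point of \<open>\<Gamma>\<close> has a near-antipode in \<open>\<Gamma>\<close> about any other. This property, \<open>near_symmetric\<close>, holds at
  all centres of \<open>\<Gamma>\<close> and all radii in question with the same small \<open>\<epsilon>\<close>. At a single centre it does
  not exclude spiralling; applied at several centres it says that every isosceles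
  triangle with vertices in \<open>\<Gamma>\<close> is nearly degenerate.

  Connectedness of \<open>\<Gamma>\<close> produces isosceles triangles. For \<open>x\<close> and \<open>y\<close> in \<open>\<Gamma>\<close>, follow \<open>\<Gamma>\<close> from \<open>x\<close> until
  it leaves the ball of radius \<open>dist x y\<close> at \<open>y'\<close>. Some point on the way is equidistant from \<open>x\<close> and
  \<open>y'\<close>, hence close to their midpoint; as \<open>y'\<close> is close to \<open>y\<close> or to its antipode, \<open>\<Gamma>\<close> has a point
  close to the midpoint of \<open>x\<close> and \<open>y\<close> (\<open>near_midpoint\<close>). The error is proportional to \<open>dist x y\<close>,
  which is halved in each bisection, so the errors of repeated bisection form a geometric series and
  the whole segment from \<open>x\<close> to \<open>y\<close> is within \<open>9 * \<epsilon> * dist x y\<close> of \<open>\<Gamma>\<close> (\<open>near_segment\<close>). Sweeping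
  segments out of a third point shows the same for triangles with vertices in \<open>\<Gamma>\<close>
  (\<open>near_triangle\<close>).

  On the other hand \<open>\<Gamma>\<close> cannot come close to every point of a disc, because then a non-degenerate
  isosceles triangle can be found in it (\<open>not_dense_in_disc\<close>). Hence a triangle with vertices in
  \<open>\<Gamma>\<close> is too thin to contain a disc of radius much larger than \<open>\<epsilon>\<close> times its diameter
  (\<open>small_height\<close>). With \<open>x\<close> the given centre and \<open>y\<close> a point of \<open>\<Gamma>\<close> at distance \<open>R\<close> from it, all of
  \<open>\<Gamma> \<inter> ball x R\<close> lies within a multiple of \<open>\<epsilon> * R\<close> of the line through \<open>x\<close> and \<open>y\<close>. This gives
  \<open>jones_beta \<Gamma> x R \<le> C * R powr \<alpha>\<close>, which for \<open>R \<le> 1\<close> is stronger than a bound by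
  \<open>C * R powr (\<alpha> / 16)\<close>.
\<close>

section \<open>Hausdorff measure of circular arcs\<close>

lemma diameter_least:
  fixes S :: "'a::metric_space set"
  assumes "0 \<le> d" "\<And>x y. x \<in> S \<Longrightarrow> y \<in> S \<Longrightarrow> dist x y \<le> d"
  shows "diameter S \<le> d"
  unfolding diameter_def using assms by (auto intro!: cSUP_least)

lemma hausdorff1_mono:
  assumes "A \<subseteq> B"
  shows "hausdorff1 A \<le> hausdorff1 B"
  unfolding hausdorff1_def hausdorff1_delta_def
  by (intro SUP_mono' INF_superset_mono) (use assms in auto)

lemma hausdorff1_nonexpansive_image:
  fixes f :: "'a::metric_space \<Rightarrow> 'b::metric_space"
  assumes f: "\<And>x y. dist (f x) (f y) \<le> dist x y"
  shows "hausdorff1 (f ` A) \<le> hausdorff1 A"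
proof -
  have diam: "bounded (f ` U) \<and> diameter (f ` U) \<le> diameter U" if "bounded U" for U
  proof
    show "bounded (f ` U)"
    proof -
      obtain x e where "\<forall>y\<in>U. dist x y \<le> e" using \<open>bounded U\<close> unfolding bounded_def by blast
      then have "\<forall>y\<in>f ` U. dist (f x) y \<le> e" using f order_trans by blast
      then show ?thesis unfolding bounded_def by blast
    qed
    show "diameter (f ` U) \<le> diameter U"
      by (rule diameter_least)
         (use that in \<open>auto intro: diameter_ge_0 order_trans[OF f diameter_bounded_bound]\<close>)
  qed
  have "hausdorff1_delta \<delta> (f ` A) \<le> hausdorff1_delta \<delta> A" for \<delta>
    unfolding hausdorff1_delta_def
  proof (rule INF_greatest)
    fix U :: "nat \<Rightarrow> 'a set"
    assume "U \<in> {U. A \<subseteq> (\<Union>i. U i) \<and> (\<forall>i. bounded (U i) \<and> diameter (U i) \<le> \<delta>)}"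
    then have U: "A \<subseteq> (\<Union>i. U i)" "\<And>i. bounded (U i)" "\<And>i. diameter (U i) \<le> \<delta>" by auto
    show "(INF V \<in> {V :: nat \<Rightarrow> 'b set. f ` A \<subseteq> (\<Union>i. V i) \<and> (\<forall>i. bounded (V i) \<and> diameter (V i) \<le> \<delta>)}.
        \<Sum>i. ennreal (diameter (V i))) \<le> (\<Sum>i. ennreal (diameter (U i)))"
    proof (rule INF_lower2)
      show "(\<lambda>i. f ` U i) \<in> {V. f ` A \<subseteq> (\<Union>i. V i) \<and> (\<forall>i. bounded (V i) \<and> diameter (V i) \<le> \<delta>)}"
        unfolding mem_Collect_eq image_UN[symmetric]
        by (intro conjI allI image_mono U(1) diam[OF U(2), THEN conjunct1]
            order_trans[OF diam[OF U(2), THEN conjunct2] U(3)])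
      show "(\<Sum>i. ennreal (diameter (f ` U i))) \<le> (\<Sum>i. ennreal (diameter (U i)))"
        by (intro suminf_le ennreal_leI) (use diam U in auto)
    qed
  qed
  then show ?thesis unfolding hausdorff1_def by (intro SUP_mono') auto
qed

text \<open>Cutting the interval into \<open>n\<close> equal pieces gives coverings of total diameter
  at most \<open>l * (b - a)\<close> and arbitrarily small mesh.\<close>

lemma hausdorff1_Lipschitz_image_le:
  fixes f :: "real \<Rightarrow> 'a::metric_space"
  assumes "a \<le> b" "0 \<le> l" and f: "\<And>s t. dist (f s) (f t) \<le> l * \<bar>s - t\<bar>"
  shows "hausdorff1 (f ` {a<..<b}) \<le> ennreal (l * (b - a))"
  unfolding hausdorff1_def
proof (rule SUP_least)
  fix \<delta> :: real assume "\<delta> \<in> {0<..}"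
  then have "\<delta> > 0" by simp
  obtain n :: nat where n: "l * (b - a) / \<delta> < real n" using reals_Archimedean2 by blast
  have "0 \<le> l * (b - a) / \<delta>" using assms \<open>\<delta> > 0\<close> by simp
  then have "n > 0" using n by (cases n) auto
  define h where "h = (b - a) / n"
  have "h \<ge> 0" using assms by (simp add: h_def)
  have lh: "l * h \<le> \<delta>" using n \<open>\<delta> > 0\<close> \<open>n > 0\<close> by (simp add: h_def field_simps)
  define U where "U i = (if i < n then f ` {a + i * h .. a + (i + 1) * h} else {})" for i :: nat
  have dist_U: "dist u v \<le> l * h" if uv: "u \<in> U i" "v \<in> U i" for u v i
  proof -
    obtain s t where st: "u = f s" "v = f t" "s \<in> {a + i * h .. a + (i + 1) * h}"
      "t \<in> {a + i * h .. a + (i + 1) * h}"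
      using uv unfolding U_def by (cases "i < n") auto
    then have "\<bar>s - t\<bar> \<le> h" by (auto simp: algebra_simps)
    then have "l * \<bar>s - t\<bar> \<le> l * h" using assms by (intro mult_left_mono) auto
    then show ?thesis using f[of s t] st by simp
  qed
  have "0 \<le> l * h" using assms \<open>h \<ge> 0\<close> by simp
  have diam: "diameter (U i) \<le> l * h" for i
    by (rule diameter_least[OF \<open>0 \<le> l * h\<close>]) (rule dist_U)
  have bdd: "bounded (U i)" for i
    unfolding bounded_two_points using dist_U by blast
  have cover: "f ` {a<..<b} \<subseteq> (\<Union>i. U i)"
  proof safe
    fix t assume t: "t \<in> {a<..<b}"
    then have "h > 0" using \<open>n > 0\<close> by (simp add: h_def)
    define i where "i = nat \<lfloor>(t - a) / h\<rfloor>"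
    have nonneg: "0 \<le> (t - a) / h" using t \<open>h > 0\<close> by simp
    have i1: "real i \<le> (t - a) / h" "(t - a) / h < real i + 1"
      using nonneg unfolding i_def by linarith+
    have "(t - a) / h < n"
      using t \<open>n > 0\<close> unfolding h_def by (auto simp: field_simps)
    then have "i < n" using i1 by linarith
    moreover have "t \<in> {a + i * h .. a + (i + 1) * h}"
      using i1 \<open>h > 0\<close> by (auto simp: field_simps)
    ultimately show "f t \<in> (\<Union>i. U i)" unfolding U_def by force
  qed
  have "hausdorff1_delta \<delta> (f ` {a<..<b}) \<le> (\<Sum>i. ennreal (diameter (U i)))"
    unfolding hausdorff1_delta_def
    by (rule INF_lower) (use cover bdd order_trans[OF diam lh] in blast)
  also have "\<dots> = (\<Sum>i<n. ennreal (diameter (U i)))"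
    by (rule suminf_finite) (auto simp: U_def)
  also have "\<dots> \<le> (\<Sum>i<n. ennreal (l * h))"
    by (intro sum_mono ennreal_leI diam)
  also have "\<dots> = ennreal (n * (l * h))"
    using \<open>0 \<le> l * h\<close> by (simp add: ennreal_mult'' ennreal_of_nat_eq_real_of_nat)
  also have "n * (l * h) = l * (b - a)" using \<open>n > 0\<close> by (simp add: h_def)
  finally show "hausdorff1_delta \<delta> (f ` {a<..<b}) \<le> ennreal (l * (b - a))" .
qed

lemma dist_rcis_le:
  assumes "0 \<le> r"
  shows "dist (x + rcis r s) (x + rcis r t) \<le> r * \<bar>s - t\<bar>"
proof -
  have "rcis r s - rcis r t = rcis r t * (exp (\<i> * of_real (s - t)) - 1)"
    by (simp add: rcis_def cis_conv_exp algebra_simps exp_diff)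
  then have "dist (x + rcis r s) (x + rcis r t) = r * (2 * \<bar>sin ((s - t) / 2)\<bar>)"
    using assms dist_exp_i_1[of "s - t"] by (simp add: dist_norm norm_mult)
  moreover have "2 * \<bar>sin ((s - t) / 2)\<bar> \<le> \<bar>s - t\<bar>"
    using abs_sin_x_le_abs_x[of "(s - t) / 2"] by simp
  ultimately show ?thesis using assms by (simp add: mult_left_mono)
qed

lemma rcis_shift: "rcis r (t + 2 * pi * of_int k) = rcis r t"
  by (simp add: rcis_def flip: cis_mult)

lemma open_circle_arc_base_point:
  assumes "open_circle_arc x r A"
  obtains a b where "c \<le> a" "a < c + 2 * pi" "a \<le> b" "b \<le> a + 2 * pi"
    "A = (\<lambda>t. x + rcis r t) ` {a<..<b}"
proof -
  obtain a b where ab: "a \<le> b" "b \<le> a + 2 * pi" "A = (\<lambda>t. x + rcis r t) ` {a<..<b}"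
    using assms unfolding open_circle_arc_def by blast
  define k where "k = \<lfloor>(a - c) / (2 * pi)\<rfloor>"
  define s where "s = 2 * pi * of_int k"
  have "of_int k \<le> (a - c) / (2 * pi)" "(a - c) / (2 * pi) < of_int k + 1"
    unfolding k_def by linarith+
  then have "s \<le> a - c" "a - c < s + 2 * pi" by (auto simp: s_def field_simps)
  moreover have "A = (\<lambda>t. x + rcis r t) ` {a - s<..<b - s}"
  proof -
    have "{a<..<b} = (\<lambda>t. t + s) ` {a - s<..<b - s}"
      by (auto intro!: image_eqI[where x = "_ - s"])
    then show ?thesis unfolding ab by (simp add: image_image s_def rcis_shift)
  qed
  ultimately show ?thesis using that[of "a - s" "b - s"] ab by auto
qed

text \<open>Rotating a shorter arc into a longer one shows that the measure of an arc is an increasing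
  function of its angle.\<close>

lemma hausdorff1_arc_mono:
  assumes "b - a \<le> b' - a'"
  shows "hausdorff1 ((\<lambda>t. x + rcis r t) ` {a<..<b}) \<le> hausdorff1 ((\<lambda>t. x + rcis r t) ` {a'<..<b'})"
proof -
  define f where "f z = x + cis (a - a') * (z - x)" for z
  have "f (x + rcis r t) = x + rcis r (t + (a - a'))" for t
    by (simp add: f_def rcis_def cis_mult algebra_simps)
  moreover have "{a<..<b} = (\<lambda>t. t + (a - a')) ` {a'<..<b - a + a'}"
    by (auto intro!: image_eqI[where x = "_ - (a - a')"])
  ultimately have "(\<lambda>t. x + rcis r t) ` {a<..<b} = f ` (\<lambda>t. x + rcis r t) ` {a'<..<b - a + a'}"
    by (simp add: image_image)
  also have "hausdorff1 \<dots> \<le> hausdorff1 ((\<lambda>t. x + rcis r t) ` {a'<..<b - a + a'})"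
  proof (rule hausdorff1_nonexpansive_image)
    fix z w
    have "f z - f w = cis (a - a') * (z - w)" by (simp add: f_def algebra_simps)
    then show "dist (f z) (f w) \<le> dist z w" by (simp add: dist_norm norm_mult)
  qed
  also have "\<dots> \<le> hausdorff1 ((\<lambda>t. x + rcis r t) ` {a'<..<b'})"
    by (intro hausdorff1_mono image_mono) (use assms in auto)
  finally show ?thesis .
qed

text \<open>The maximum defining the largest arc is attained for every set \<open>D\<close>: if the open arcs over
  \<open>(a\<^sub>n, b\<^sub>n)\<close> lie in \<open>D\<close> and \<open>(a\<^sub>n, b\<^sub>n)\<close> tends to \<open>(a, b)\<close>, then the open arc over \<open>(a, b)\<close>
  lies in \<open>D\<close> too. The admissible pairs of endpoints thus form a compact set, and a pair maximizing the
  angle maximizes the measure as well.\<close>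

lemma largest_arc_is_arc:
  "open_circle_arc x r (largest_arc D x r) \<and> largest_arc D x r \<subseteq> D"
proof -
  let ?arc = "\<lambda>p. (\<lambda>t. x + rcis r t) ` {fst p<..<snd p}"
  define P where "P = {p::real \<times> real. 0 \<le> fst p} \<inter> {p. fst p \<le> 2 * pi} \<inter> {p. fst p \<le> snd p} \<inter>
     {p. snd p \<le> fst p + 2 * pi} \<inter>
     (\<Inter>t\<in>{t. x + rcis r t \<notin> D}. {p. t \<le> fst p} \<union> {p. snd p \<le> t})"
  have P_iff: "p \<in> P \<longleftrightarrow> 0 \<le> fst p \<and> fst p \<le> 2 * pi \<and> fst p \<le> snd p \<and> snd p \<le> fst p + 2 * pi \<and> ?arc p \<subseteq> D" for p
  proof -
    have "?arc p \<subseteq> D \<longleftrightarrow> (\<forall>t. x + rcis r t \<notin> D \<longrightarrow> t \<le> fst p \<or> snd p \<le> t)"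
    proof -
      have "?arc p \<subseteq> D \<longleftrightarrow> (\<forall>t. x + rcis r t \<notin> D \<longrightarrow> \<not> (fst p < t \<and> t < snd p))"
        unfolding image_subset_iff greaterThanLessThan_iff Ball_def by blast
      then show ?thesis by (simp only: de_Morgan_conj not_less)
    qed
    then show ?thesis unfolding P_def by simp
  qed
  have "closed P"
    unfolding P_def by (intro closed_Int closed_INT ballI closed_Un closed_Collect_le continuous_intros)
  moreover have "bounded P"
    by (rule bounded_subset[of "{0..2*pi} \<times> {0..4*pi}"]) (auto simp: P_def intro!: bounded_Times)
  ultimately have "compact P" by (simp add: compact_eq_bounded_closed)
  moreover have "(0, 0) \<in> P" by (simp add: P_iff)
  moreover have "continuous_on P (\<lambda>p. snd p - fst p)" by (intro continuous_intros)
  ultimately obtain m where m: "m \<in> P" "\<And>p. p \<in> P \<Longrightarrow> snd p - fst p \<le> snd m - fst m"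
    using continuous_attains_sup[of P "\<lambda>p. snd p - fst p"] by blast
  show ?thesis unfolding largest_arc_def
  proof (rule arg_maxI[where x = "?arc m"])
    show "open_circle_arc x r (?arc m) \<and> ?arc m \<subseteq> D"
      using m(1) unfolding P_iff open_circle_arc_def by blast
    fix A assume A: "open_circle_arc x r A \<and> A \<subseteq> D"
    then obtain a b where ab: "0 \<le> a" "a < 0 + 2 * pi" "a \<le> b" "b \<le> a + 2 * pi" "A = ?arc (a, b)"
      using open_circle_arc_base_point[of x r A 0] by auto
    then have "(a, b) \<in> P" unfolding P_iff using A by auto
    then have "b - a \<le> snd m - fst m" using m(2) by fastforce
    then show "\<not> hausdorff1 (?arc m) < hausdorff1 A"
      using hausdorff1_arc_mono ab(5) by (simp add: not_less)
  qed
qed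

text \<open>The measure of an arc is at most \<open>r\<close> times its angle, so a lower bound on the measure becomes one
  on the angle. The free base point \<open>c\<close> serves to bring the arcs
  of two disjoint sets into a common period.\<close>

lemma large_largest_arc:
  assumes "0 < r" "s * r \<le> enn2real (hausdorff1 (largest_arc D x r))"
  obtains a b where "c \<le> a" "a < c + 2 * pi" "a \<le> b" "b \<le> a + 2 * pi" "s \<le> b - a"
    "\<And>t. a < t \<Longrightarrow> t < b \<Longrightarrow> x + rcis r t \<in> D"
proof -
  obtain a b where ab: "c \<le> a" "a < c + 2 * pi" "a \<le> b" "b \<le> a + 2 * pi"
     "largest_arc D x r = (\<lambda>t. x + rcis r t) ` {a<..<b}"
    using open_circle_arc_base_point[of x r "largest_arc D x r" c] largest_arc_is_arc by metis
  have "hausdorff1 (largest_arc D x r) \<le> ennreal (r * (b - a))"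
    unfolding ab(5) using assms ab
    by (intro hausdorff1_Lipschitz_image_le dist_rcis_le) auto
  then have "enn2real (hausdorff1 (largest_arc D x r)) \<le> r * (b - a)"
    using assms ab by (intro enn2real_leI) auto
  then have "s * r \<le> (b - a) * r" using assms(2) by (simp add: mult.commute)
  then have "s \<le> b - a" using assms(1) by (simp only: mult_le_cancel_right_pos)
  moreover have "x + rcis r t \<in> D" if "a < t" "t < b" for t
    using largest_arc_is_arc[of x r D] that unfolding ab(5) by (simp add: image_subset_iff)
  ultimately show ?thesis using that ab by blast
qed

section \<open>Near-symmetric connected sets are flat\<close>

text \<open>The defining condition is stated relative to one point \<open>p\<close> of the circle, so that it also covers
  radii for which the circle misses \<open>G\<close>. The vector \<open>p + q - 2 *\<^sub>R x\<close> measures how far \<open>q\<close> is from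
  the antipode of \<open>p\<close> about \<open>x\<close>.\<close>

definition near_symmetric :: "complex set \<Rightarrow> real \<Rightarrow> real \<Rightarrow> bool" where
  "near_symmetric G \<epsilon> s \<longleftrightarrow>
     (\<forall>x\<in>G. \<forall>p\<in>G. 0 < dist x p \<and> dist x p \<le> s \<longrightarrow>
        (\<exists>q\<in>G. dist x q = dist x p \<and> dist (p + q) (2 *\<^sub>R x) \<le> \<epsilon> * dist x p) \<and>
        (\<forall>q\<in>G. dist x q = dist x p \<longrightarrow>
           dist p q \<le> \<epsilon> * dist x p \<or> dist (p + q) (2 *\<^sub>R x) \<le> \<epsilon> * dist x p))"

text \<open>Stopping the path at the first exit keeps it inside the closed ball; the distance control this
  gives is what allows the near-symmetry to be used at the radii where it is known.\<close>

lemma path_connected_exit_ball: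
  fixes x :: "'a::euclidean_space"
  assumes "path_connected G" "x \<in> G" "y \<in> G" "0 < R" "R \<le> dist x y"
  obtains K z where "connected K" "K \<subseteq> G" "K \<subseteq> cball x R" "x \<in> K" "z \<in> K" "dist x z = R"
proof -
  obtain g where g: "path g" "path_image g \<subseteq> G" "pathstart g = x" "pathfinish g = y"
    using assms unfolding path_connected_def by blast
  obtain h where h: "path h" "pathstart h = x" "path_image h \<subseteq> path_image g"
    "path_image h - {pathfinish h} \<subseteq> interior (ball x R)" "pathfinish h \<in> frontier (ball x R)"
    using exists_path_subpath_to_frontier[OF g(1), of "ball x R"] g assms by auto
  have fin: "dist x (pathfinish h) = R" using h(5) assms by simp
  show ?thesis
  proof (rule that)
    show "connected (path_image h)" using h by (simp add: connected_path_image)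
    show "path_image h \<subseteq> G" using h g by blast
    show "path_image h \<subseteq> cball x R" using h(4) fin by fastforce
    show "x \<in> path_image h" "pathfinish h \<in> path_image h"
      using h(2) pathstart_in_path_image[of h] pathfinish_in_path_image by auto
  qed (rule fin)
qed

lemma connected_equidistant_point:
  fixes p q :: "'a::metric_space"
  assumes "connected K" "x \<in> K" "z \<in> K" "dist x p \<le> dist x q" "dist z q \<le> dist z p"
  obtains w where "w \<in> K" "dist w p = dist w q"
proof -
  let ?f = "\<lambda>w. dist w p - dist w q"
  have "connected (?f ` K)"
    by (intro connected_continuous_image continuous_intros assms)
  then have "{?f x..?f z} \<subseteq> ?f ` K"
    using assms(2,3) by (intro connected_contains_Icc) auto
  then have "0 \<in> ?f ` K" using assms by auto
  then show ?thesis using that by auto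
qed

text \<open>The bound \<open>1/9\<close> ensures that a point and its near-antipode are well separated and that
  each half of a bisected segment has at most \<open>3/4\<close> of its length.\<close>

locale near_symmetric_set =
  fixes G :: "complex set" and \<epsilon> s :: real
  assumes path_connected: "path_connected G"
    and near_symmetric: "near_symmetric G \<epsilon> s"
    and eps_pos: "0 < \<epsilon>" and eps_small: "\<epsilon> \<le> 1/9"
begin

lemma antipode:
  assumes "x \<in> G" "p \<in> G" "0 < dist x p" "dist x p \<le> s"
  obtains q where "q \<in> G" "dist (p + q) (2 *\<^sub>R x) \<le> \<epsilon> * dist x p"
  using assms near_symmetric unfolding near_symmetric_def by blast

lemma near_or_antipodal:
  assumes "x \<in> G" "p \<in> G" "q \<in> G" "0 < dist x p" "dist x p \<le> s" "dist x q = dist x p"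
  shows "dist p q \<le> \<epsilon> * dist x p \<or> dist (p + q) (2 *\<^sub>R x) \<le> \<epsilon> * dist x p"
  using assms near_symmetric unfolding near_symmetric_def by blast

text \<open>An equidistant point \<open>w\<close> of \<open>x\<close> and the exit point \<open>y'\<close> is at distance at least half of
  \<open>dist x y\<close> from them, so \<open>x\<close> and \<open>y'\<close> are too far apart to be in the same cluster about \<open>w\<close>. Thus
  they are nearly antipodal, and \<open>w\<close> is close to their midpoint. If \<open>y'\<close> is near the antipode of
  \<open>y\<close> rather than near \<open>y\<close>, the antipode of \<open>w\<close> about \<open>x\<close> is the required point.\<close>

lemma near_midpoint:
  assumes "x \<in> G" "y \<in> G" "0 < dist x y" "dist x y \<le> s"
  obtains m where "m \<in> G" "dist m (midpoint x y) \<le> 2 * \<epsilon> * dist x y"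
proof -
  define R where "R = dist x y"
  define \<eta> where "\<eta> = \<epsilon> * R"
  obtain K y' where K: "connected K" "K \<subseteq> G" "K \<subseteq> cball x R" "x \<in> K" "y' \<in> K" "dist x y' = R"
    using path_connected_exit_ball[OF path_connected assms(1-3)] unfolding R_def by auto
  obtain w where w: "w \<in> K" "dist w x = dist w y'"
    using connected_equidistant_point[OF K(1,4,5), of x y'] by auto
  have wR: "dist w x \<le> R" using w K by (auto simp: dist_commute)
  have "R \<le> dist w x + dist w y'" using dist_triangle[of x y' w] K by (simp add: dist_commute)
  then have w0: "0 < dist w x" using w assms R_def by auto
  have scale: "\<epsilon> * dist w x \<le> \<eta>" unfolding \<eta>_def using wR eps_pos by simp
  have "\<eta> \<le> R / 9" unfolding \<eta>_def using mult_right_mono[OF eps_small, of R] assms R_def by simp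
  then have "\<not> dist x y' \<le> \<epsilon> * dist w x" using K scale assms R_def by linarith
  moreover have "dist x y' \<le> \<epsilon> * dist w x \<or> dist (x + y') (2 *\<^sub>R w) \<le> \<epsilon> * dist w x"
    using K w w0 wR assms R_def by (intro near_or_antipodal) auto
  ultimately have A: "dist (x + y') (2 *\<^sub>R w) \<le> \<eta>" using scale by linarith
  have "dist y y' \<le> \<eta> \<or> dist (y + y') (2 *\<^sub>R x) \<le> \<eta>"
    unfolding \<eta>_def R_def using K assms R_def by (intro near_or_antipodal) auto
  then consider "dist y y' \<le> \<eta>" | "dist (y + y') (2 *\<^sub>R x) \<le> \<eta>" by blast
  then show ?thesis
  proof cases
    case 1
    have "w - midpoint x y = (1/2) *\<^sub>R ((y' - y) - ((x + y') - 2 *\<^sub>R w))"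
      by (simp add: midpoint_def algebra_simps)
    then have "dist w (midpoint x y) = 1/2 * norm ((y' - y) - ((x + y') - 2 *\<^sub>R w))"
      by (simp add: dist_norm)
    also have "\<dots> \<le> 1/2 * (dist y y' + dist (x + y') (2 *\<^sub>R w))"
      by (metis dist_norm dist_commute norm_triangle_ineq4 mult_left_mono zero_le_divide_1_iff zero_le_numeral)
    finally have "dist w (midpoint x y) \<le> \<eta>" using 1 A by argo
    moreover have "0 \<le> \<eta>" unfolding \<eta>_def using eps_pos R_def by simp
    ultimately show ?thesis using that[of w] w K R_def \<eta>_def by auto
  next
    case 2
    obtain q where q: "q \<in> G" "dist (w + q) (2 *\<^sub>R x) \<le> \<epsilon> * dist x w"
      using antipode[of x w] w w0 wR K assms R_def by (auto simp: dist_commute)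
    then have "dist (w + q) (2 *\<^sub>R x) \<le> \<eta>" using scale by (simp add: dist_commute)
    have "q - midpoint x y = ((w + q) - 2 *\<^sub>R x)
        + (1/2) *\<^sub>R (((x + y') - 2 *\<^sub>R w) - ((y + y') - 2 *\<^sub>R x))"
      by (simp add: midpoint_def scaleR_conv_of_real field_simps)
    then have "dist q (midpoint x y) \<le> dist (w + q) (2 *\<^sub>R x)
        + 1/2 * norm (((x + y') - 2 *\<^sub>R w) - ((y + y') - 2 *\<^sub>R x))"
      unfolding dist_norm by (metis norm_triangle_ineq norm_scaleR abs_of_nonneg zero_le_divide_1_iff zero_le_numeral)
    moreover have "norm (((x + y') - 2 *\<^sub>R w) - ((y + y') - 2 *\<^sub>R x))
        \<le> dist (x + y') (2 *\<^sub>R w) + dist (y + y') (2 *\<^sub>R x)"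
      unfolding dist_norm by (rule norm_triangle_ineq4)
    ultimately have "dist q (midpoint x y) \<le> 2 * \<eta>"
      using 2 A \<open>dist (w + q) (2 *\<^sub>R x) \<le> \<eta>\<close> by argo
    then show ?thesis using that[of q] q R_def \<eta>_def by (simp add: mult.assoc)
  qed
qed

text \<open>If \<open>e\<close> is the error relative to \<open>dist x y\<close>, one bisection turns \<open>e\<close> into at most
  \<open>3/4 * e + 2 * \<epsilon>\<close>; this map has the fixed point \<open>8 * \<epsilon>\<close>.\<close>

lemma near_segment_dyadic:
  assumes "x \<in> G" "y \<in> G" "dist x y \<le> s" "0 \<le> t" "t \<le> 1"
  shows "\<exists>z\<in>G. dist z (x + t *\<^sub>R (y - x)) \<le> ((3/4) ^ k + 8 * \<epsilon>) * dist x y"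
  using assms
proof (induction k arbitrary: x y t)
  case 0
  have "dist x (x + t *\<^sub>R (y - x)) = t * dist x y"
    using 0 by (simp add: dist_norm norm_minus_commute)
  also have "\<dots> \<le> ((3/4) ^ 0 + 8 * \<epsilon>) * dist x y"
    by (rule mult_right_mono) (use 0 eps_pos in auto)
  finally show ?case using 0 by blast
next
  case (Suc k)
  have half: "\<exists>z\<in>G. dist z (x + t *\<^sub>R (y - x)) \<le> ((3/4) ^ Suc k + 8 * \<epsilon>) * dist x y"
    if xy: "x \<in> G" "y \<in> G" "dist x y \<le> s" "0 \<le> t" "t \<le> 1/2" for x y t
  proof (cases "x = y")
    case True
    then show ?thesis using xy by auto
  next
    case False
    define R where "R = dist x y"
    obtain m where m: "m \<in> G" "dist m (midpoint x y) \<le> 2 * \<epsilon> * R"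
      using near_midpoint[of x y] xy False R_def by auto
    have "dist x (midpoint x y) = R / 2" unfolding R_def by (simp add: dist_midpoint)
    then have "dist x m \<le> R / 2 + 2 * \<epsilon> * R"
      using m(2) dist_triangle[of x m "midpoint x y"] by (simp add: dist_commute)
    moreover have "\<epsilon> * R \<le> R / 9" using mult_right_mono[OF eps_small, of R] R_def by simp
    ultimately have xm: "dist x m \<le> 3/4 * R" using R_def zero_le_dist[of x y] by linarith
    then have "dist x m \<le> s" using xy R_def zero_le_dist[of x y] by linarith
    then obtain z where z: "z \<in> G"
      "dist z (x + (2 * t) *\<^sub>R (m - x)) \<le> ((3/4) ^ k + 8 * \<epsilon>) * dist x m"
      using Suc.IH[of x m "2 * t"] xy m by auto
    have "((3/4) ^ k + 8 * \<epsilon>) * dist x m \<le> ((3/4) ^ k + 8 * \<epsilon>) * (3/4 * R)"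
      by (rule mult_left_mono[OF xm]) (use eps_pos in auto)
    moreover have "dist (x + (2 * t) *\<^sub>R (m - x)) (x + t *\<^sub>R (y - x)) \<le> 2 * \<epsilon> * R"
    proof -
      have "x + (2 * t) *\<^sub>R (m - x) - (x + t *\<^sub>R (y - x)) = (2 * t) *\<^sub>R (m - midpoint x y)"
        by (simp add: midpoint_def scaleR_conv_of_real field_simps)
      then have "dist (x + (2 * t) *\<^sub>R (m - x)) (x + t *\<^sub>R (y - x)) = 2 * t * dist m (midpoint x y)"
        using xy by (simp add: dist_norm)
      also have "\<dots> \<le> 1 * dist m (midpoint x y)" by (rule mult_right_mono) (use xy in auto)
      finally show ?thesis using m by simp
    qed
    ultimately have "dist z (x + t *\<^sub>R (y - x)) \<le> ((3/4) ^ k + 8 * \<epsilon>) * (3/4 * R) + 2 * \<epsilon> * R"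
      using z(2) dist_triangle[of z "x + t *\<^sub>R (y - x)" "x + (2 * t) *\<^sub>R (m - x)"] by linarith
    also have "\<dots> = ((3/4) ^ Suc k + 8 * \<epsilon>) * R" by (simp add: algebra_simps)
    finally show ?thesis using z R_def by blast
  qed
  show ?case
  proof (cases "t \<le> 1/2")
    case True
    then show ?thesis using half Suc.prems by blast
  next
    case False
    have "y + (1 - t) *\<^sub>R (x - y) = x + t *\<^sub>R (y - x)" by (simp add: algebra_simps)
    then show ?thesis using half[of y x "1 - t"] Suc.prems False by (simp add: dist_commute)
  qed
qed

lemma near_segment:
  assumes "x \<in> G" "y \<in> G" "dist x y \<le> s" "0 \<le> t" "t \<le> 1"
  obtains z where "z \<in> G" "dist z (x + t *\<^sub>R (y - x)) \<le> 9 * \<epsilon> * dist x y"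
proof -
  obtain k where "(3/4::real) ^ k < \<epsilon>" using real_arch_pow_inv[OF eps_pos, of "3/4"] by force
  then have "((3/4) ^ k + 8 * \<epsilon>) * dist x y \<le> 9 * \<epsilon> * dist x y"
    by (intro mult_right_mono) auto
  then show ?thesis using near_segment_dyadic[OF assms, of k] that by force
qed

text \<open>A point of the triangle lies on a segment from \<open>w\<close> to a point \<open>p\<close> of the opposite side. Replacing
  \<open>p\<close> by a nearby \<open>p'\<close> in \<open>G\<close> costs \<open>9 * \<epsilon> * d\<close>, and \<open>G\<close> follows the segment from \<open>p'\<close> to \<open>w\<close>, of length at
  most \<open>2 * d\<close>, up to another \<open>18 * \<epsilon> * d\<close>.\<close>

lemma near_triangle:
  assumes "x \<in> G" "y \<in> G" "w \<in> G" "dist x y \<le> d" "dist x w \<le> d" "dist y w \<le> d" "2 * d \<le> s"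
    and "0 \<le> a" "0 \<le> b" "a + b \<le> 1"
  obtains z where "z \<in> G" "dist z (x + a *\<^sub>R (y - x) + b *\<^sub>R (w - x)) \<le> 27 * \<epsilon> * d"
proof (cases "b = 1")
  case True
  then have "x + a *\<^sub>R (y - x) + b *\<^sub>R (w - x) = w" using assms by simp
  moreover have "0 \<le> d" using assms(4) zero_le_dist[of x y] by linarith
  moreover have "0 \<le> 27 * \<epsilon> * d" using eps_pos \<open>0 \<le> d\<close> by simp
  ultimately show ?thesis using that[of w] assms by simp
next
  case False
  have "0 \<le> d" using assms zero_le_dist[of x y] by linarith
  define c where "c = a / (1 - b)"
  have c: "0 \<le> c" "c \<le> 1" "(1 - b) * c = a" using False assms by (auto simp: c_def field_simps)
  define p where "p = x + c *\<^sub>R (y - x)"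
  obtain p' where p': "p' \<in> G" "dist p' p \<le> 9 * \<epsilon> * dist x y"
    using near_segment[of x y c] assms c \<open>0 \<le> d\<close> unfolding p_def by auto
  have "9 * \<epsilon> * dist x y \<le> 9 * \<epsilon> * d" using assms eps_pos by simp
  then have p'p: "dist p' p \<le> 9 * \<epsilon> * d" using p' by linarith
  have "dist p w = norm ((1 - c) *\<^sub>R (x - w) + c *\<^sub>R (y - w))"
    unfolding p_def dist_norm by (simp add: algebra_simps)
  also have "\<dots> \<le> (1 - c) * dist x w + c * dist y w"
    using norm_triangle_ineq[of "(1 - c) *\<^sub>R (x - w)" "c *\<^sub>R (y - w)"] c by (simp add: dist_norm)
  also have "\<dots> \<le> (1 - c) * d + c * d"
    by (intro add_mono mult_left_mono) (use c assms in auto)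
  also have "\<dots> = d" by (simp add: algebra_simps)
  finally have "dist p w \<le> d" .
  moreover have "\<epsilon> * d \<le> d / 9" using mult_right_mono[OF eps_small \<open>0 \<le> d\<close>] by simp
  ultimately have p'w: "dist p' w \<le> 2 * d"
    using p'p dist_triangle[of p' w p] by simp
  obtain z where z: "z \<in> G" "dist z (p' + b *\<^sub>R (w - p')) \<le> 9 * \<epsilon> * dist p' w"
    using near_segment[of p' w b] p' assms p'w by auto
  have zz: "9 * \<epsilon> * dist p' w \<le> 9 * \<epsilon> * (2 * d)"
    by (rule mult_left_mono[OF p'w]) (use eps_pos in auto)
  have target: "x + a *\<^sub>R (y - x) + b *\<^sub>R (w - x) = p + b *\<^sub>R (w - p)"
    unfolding p_def c(3)[symmetric] by (simp add: algebra_simps)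
  have "p' + b *\<^sub>R (w - p') - (p + b *\<^sub>R (w - p)) = (1 - b) *\<^sub>R (p' - p)"
    by (simp add: algebra_simps)
  then have "dist (p' + b *\<^sub>R (w - p')) (p + b *\<^sub>R (w - p)) = (1 - b) * dist p' p"
    using assms by (simp add: dist_norm)
  also have "\<dots> \<le> 1 * dist p' p" by (rule mult_right_mono) (use assms in auto)
  finally have "dist (p' + b *\<^sub>R (w - p')) (p + b *\<^sub>R (w - p)) \<le> 9 * \<epsilon> * d" using p'p by simp
  then have "dist z (p + b *\<^sub>R (w - p)) \<le> 27 * \<epsilon> * d"
    using z(2) zz dist_triangle[of z "p + b *\<^sub>R (w - p)" "p' + b *\<^sub>R (w - p')"] by simp
  then show ?thesis using that z target by simp
qed

text \<open>Follow \<open>G\<close> from \<open>x\<close> near the centre to its exit point \<open>y = x + u\<close> from the ball of radius \<open>\<rho>\<close>. Density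
  supplies points \<open>p\<close> and \<open>q\<close> of \<open>G\<close> such that \<open>x\<close>, \<open>y\<close>, \<open>q\<close>, \<open>p\<close> are nearly the corners of a rectangle
  with sides \<open>\<rho>\<close> and \<open>3 * \<rho>\<close>. As \<open>x\<close> is closer to \<open>p\<close> and \<open>y\<close> is closer to \<open>q\<close>, some point \<open>w\<close> on the way
  is equidistant from \<open>p\<close> and \<open>q\<close>. But \<open>p\<close> and \<open>q\<close> are a distance of about \<open>\<rho>\<close> apart and both
  lie on the same side of \<open>w\<close>, so they are neither close together nor nearly antipodal about \<open>w\<close>.\<close>

lemma not_dense_in_disc:
  assumes "0 < \<rho>" "5 * \<rho> \<le> s"
  shows "\<exists>u\<in>cball c (6 * \<rho>). \<forall>z\<in>G. \<rho> / 20 < dist z u"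
proof (rule ccontr)
  assume "\<not> ?thesis"
  then have dense: "\<exists>z\<in>G. dist z u \<le> \<rho> / 20" if "dist c u \<le> 6 * \<rho>" for u
    using that by (auto simp: not_less)
  obtain x where x: "x \<in> G" "dist x c \<le> \<rho> / 20" using dense[of c] assms by auto
  obtain x0 where x0: "x0 \<in> G" "dist x0 (c + of_real (3 * \<rho>)) \<le> \<rho> / 20"
    using dense[of "c + of_real (3 * \<rho>)"] assms by (auto simp: dist_norm norm_mult)
  have "3 * \<rho> \<le> dist c (c + of_real (3 * \<rho>))" using assms by (simp add: dist_norm norm_mult)
  then have "\<rho> \<le> dist x x0" using x(2) x0(2) assms(1) by norm
  then obtain K y where K: "connected K" "K \<subseteq> G" "K \<subseteq> cball x \<rho>" "x \<in> K" "y \<in> K" "dist x y = \<rho>"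
    using path_connected_exit_ball[OF path_connected x(1) x0(1) assms(1)] by blast
  define u where "u = y - x"
  have u_eq: "norm u = \<rho>" using K by (simp add: u_def dist_norm norm_minus_commute)
  then have u: "norm u \<le> \<rho>" "\<rho> \<le> norm u" by simp_all
  define v where "v = 3 * \<i> * u"
  have v: "norm v \<le> 3 * \<rho>" "3 * \<rho> \<le> norm v" by (simp_all add: v_def norm_mult u_eq)
  \<comment> \<open>The diagonals have length \<open>sqrt 10 * \<rho>\<close>; they exceed the long sides by more than the two
    density errors of \<open>\<rho> / 20\<close> together.\<close>
  have diag: "(63/20) * \<rho> \<le> norm (v + u)" "(63/20) * \<rho> \<le> norm (v - u)"
  proof -
    have "v + u = (1 + 3 * \<i>) * u" "v - u = (- 1 + 3 * \<i>) * u" by (simp_all add: v_def algebra_simps)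
    moreover have "63/20 \<le> norm (1 + 3 * \<i>)" "63/20 \<le> norm (- 1 + 3 * \<i>)"
    proof -
      have "63/20 \<le> sqrt 10" by (rule real_le_rsqrt) (simp add: power2_eq_square)
      then show "63/20 \<le> norm (1 + 3 * \<i>)" "63/20 \<le> norm (- 1 + 3 * \<i>)"
        by (simp_all add: cmod_def)
    qed
    ultimately show "(63/20) * \<rho> \<le> norm (v + u)" "(63/20) * \<rho> \<le> norm (v - u)"
      using assms u_eq by (simp_all add: norm_mult mult_right_mono)
  qed
  have "dist c (x + v) \<le> 6 * \<rho>" "dist c (x + v + u) \<le> 6 * \<rho>"
    using x(2) u(1) v(1) assms(1) by norm+
  then obtain p q where p: "p \<in> G" "dist p (x + v) \<le> \<rho> / 20" and q: "q \<in> G" "dist q (x + v + u) \<le> \<rho> / 20"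
    using dense by blast
  have y: "y = x + u" by (simp add: u_def)
  have "dist x p \<le> dist x q" using p(2) q(2) v(1) diag(1) assms(1) by norm
  moreover have "dist y q \<le> dist y p"
    unfolding y using p(2) q(2) v(1) diag(2) assms(1) by norm
  ultimately obtain w where w: "w \<in> K" "dist w p = dist w q"
    using connected_equidistant_point[OF K(1,4,5)] by blast
  then have xw: "dist x w \<le> \<rho>" "w \<in> G" using K by auto
  have wp: "dist w p \<le> 5 * \<rho>" using p(2) v(1) xw(1) assms(1) by norm
  have "\<rho> \<le> dist w p" using p(2) v(2) xw(1) assms(1) by norm
  then have "0 < dist w p" using assms(1) by linarith
  moreover have "dist w p \<le> s" using wp assms(2) by linarith
  ultimately have "dist p q \<le> \<epsilon> * dist w p \<or> dist (p + q) (2 *\<^sub>R w) \<le> \<epsilon> * dist w p"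
    using w(2) xw(2) p(1) q(1) by (intro near_or_antipodal) simp_all
  moreover have "\<epsilon> * dist w p \<le> 1/9 * (5 * \<rho>)"
    by (rule mult_mono) (use eps_small wp in auto)
  moreover have "9/10 * \<rho> \<le> dist p q" using p(2) q(2) u(2) by norm
  moreover have "2 * \<rho> \<le> dist (p + q) (2 *\<^sub>R w)"
  proof -
    have "dist (p + q) (2 *\<^sub>R (x + v) + u) \<le> \<rho> / 10" using p(2) q(2) by norm
    moreover have "dist (2 *\<^sub>R w) (2 *\<^sub>R x) \<le> 2 * \<rho>" using xw(1) by norm
    moreover have "5 * \<rho> \<le> dist (2 *\<^sub>R (x + v) + u) (2 *\<^sub>R x)"
      using norm_diff_ineq[of "2 *\<^sub>R v" u] u(1) v(2) by (simp add: dist_norm scaleR_add_right)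
    moreover have "dist (2 *\<^sub>R (x + v) + u) (2 *\<^sub>R x) \<le> dist (p + q) (2 *\<^sub>R (x + v) + u)
        + dist (p + q) (2 *\<^sub>R w) + dist (2 *\<^sub>R w) (2 *\<^sub>R x)"
      by norm
    ultimately show ?thesis using assms(1) by linarith
  qed
  ultimately show False using assms(1) by linarith
qed

text \<open>The quotient \<open>(w - x) / (y - x)\<close> expresses \<open>w\<close> in coordinates where \<open>x\<close> is \<open>0\<close> and \<open>y\<close> is \<open>1\<close>, so its
  imaginary part \<open>b\<close> is the height of \<open>w\<close> over the line through \<open>x\<close> and \<open>y\<close>, in units of \<open>R = dist x y\<close>.
  The triangle contains the disc of radius \<open>\<bar>b\<bar> * R / 12\<close> about its centroid, and \<open>G\<close> is within
  \<open>54 * \<epsilon> * R\<close> of each of its points. This contradicts \<open>not_dense_in_disc\<close> for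
  \<open>\<rho> = \<bar>b\<bar> * R / 72\<close> as soon as \<open>54 * \<epsilon> * R \<le> \<rho> / 20\<close>, that is, \<open>77760 * \<epsilon> \<le> \<bar>b\<bar>\<close>.\<close>

lemma small_height:
  assumes G: "x \<in> G" "y \<in> G" "w \<in> G" and R: "0 < dist x y" "dist x w \<le> dist x y" "4 * dist x y \<le> s"
  shows "\<bar>Im ((w - x) / (y - x))\<bar> \<le> 77760 * \<epsilon>"
proof (rule ccontr)
  define R where "R = dist x y"
  define W where "W = (w - x) / (y - x)"
  define b where "b = Im W"
  assume "\<not> ?thesis"
  then have b: "77760 * \<epsilon> < \<bar>b\<bar>" by (simp add: b_def W_def)
  have R0: "0 < R" "norm (y - x) = R" using R by (auto simp: R_def dist_norm norm_minus_commute)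
  have W: "norm W \<le> 1"
    using R R0 by (simp add: W_def norm_divide R_def dist_norm norm_minus_commute)
  have wx: "w - x = W * (y - x)" using R by (simp add: W_def)
  have b1: "\<bar>b\<bar> \<le> 1" using W abs_Im_le_cmod[of W] by (simp add: b_def)
  have b0: "0 < \<bar>b\<bar>" using b eps_pos by linarith
  define \<rho> where "\<rho> = \<bar>b\<bar> * R / 72"
  define c where "c = x + (1/3) *\<^sub>R (y - x) + (1/3) *\<^sub>R (w - x)"
  have \<rho>: "0 < \<rho>" using b0 R0 by (simp add: \<rho>_def)
  have "\<bar>b\<bar> * R \<le> R" using b1 R0 by simp
  then have "5 * \<rho> \<le> s" using R R0 unfolding \<rho>_def R_def[symmetric] by linarith
  have "\<exists>z\<in>G. dist z u \<le> \<rho> / 20" if u: "u \<in> cball c (6 * \<rho>)" for u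
  proof -
    define V where "V = (u - c) / (y - x)"
    have uc: "u - c = V * (y - x)" using R by (simp add: V_def)
    have "norm (u - c) \<le> \<bar>b\<bar> * R / 12"
      using u by (simp add: \<rho>_def dist_norm norm_minus_commute mult.commute)
    then have V: "norm V \<le> \<bar>b\<bar> / 12" using R0 by (simp add: V_def norm_divide field_simps mult.commute)
    define t where "t = Im V / b"
    define \<sigma> where "\<sigma> = Re V - t * Re W"
    \<comment> \<open>Barycentric coordinates of \<open>u\<close> relative to the centroid.\<close>
    have Vt: "V = of_real \<sigma> + of_real t * W"
      using b0 by (simp add: complex_eq_iff \<sigma>_def t_def b_def)
    have t: "\<bar>t\<bar> \<le> 1/12"
      using V abs_Im_le_cmod[of V] b0 by (simp add: t_def field_simps)
    have "\<bar>t * Re W\<bar> \<le> 1/12 * 1"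
      unfolding abs_mult by (rule mult_mono) (use t W abs_Re_le_cmod[of W] in auto)
    moreover have "\<bar>Re V\<bar> \<le> 1/12" using V b1 abs_Re_le_cmod[of V] by linarith
    ultimately have \<sigma>: "\<bar>\<sigma>\<bar> \<le> 1/6" unfolding \<sigma>_def by linarith
    have "u = c + V * (y - x)" using uc by (simp add: algebra_simps)
    also have "\<dots> = x + (1/3 + \<sigma>) *\<^sub>R (y - x) + (1/3 + t) *\<^sub>R (w - x)"
      unfolding c_def Vt wx by (simp add: scaleR_conv_of_real algebra_simps)
    finally have u_eq: "u = x + (1/3 + \<sigma>) *\<^sub>R (y - x) + (1/3 + t) *\<^sub>R (w - x)" .
    have "dist y w \<le> 2 * R" using R dist_triangle[of y w x] by (simp add: R_def dist_commute)
    moreover have "0 \<le> 1/3 + \<sigma>" "0 \<le> 1/3 + t" "1/3 + \<sigma> + (1/3 + t) \<le> 1"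
      using t \<sigma> by linarith+
    ultimately obtain z where "z \<in> G" "dist z u \<le> 27 * \<epsilon> * (2 * R)"
      using near_triangle[of x y w "2 * R" "1/3 + \<sigma>" "1/3 + t"] G R R0(1) u_eq unfolding R_def by auto
    moreover have "77760 * \<epsilon> * R \<le> \<bar>b\<bar> * R" using b R0 by simp
    ultimately show ?thesis unfolding \<rho>_def by (intro bexI[of _ z]) auto
  qed
  then show False using not_dense_in_disc[OF \<rho> \<open>5 * \<rho> \<le> s\<close>, of c] by fastforce
qed

lemma jones_beta_le:
  assumes "x \<in> G" "y \<in> G" "0 < R" "R \<le> dist x y" "4 * R \<le> s"
  shows "jones_beta G x R \<le> 77760 * \<epsilon>"
proof -
  obtain K y where "K \<subseteq> G" "y \<in> K" "dist x y = R"
    by (rule path_connected_exit_ball[OF path_connected assms(1-4)])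
  then have y: "y \<in> G" "dist x y = R" by auto
  define L where "L = affine hull {x, y}"
  let ?lines = "{L. affine L \<and> aff_dim L = 1 \<and> L \<inter> ball x R \<noteq> {}}"
  let ?height = "\<lambda>L. SUP y \<in> G \<inter> ball x R. infdist y L"
  have "x \<noteq> y" using y assms by auto
  have "x \<in> L" by (simp add: L_def hull_inc)
  have "infdist w L \<le> 77760 * \<epsilon> * R" if w: "w \<in> G \<inter> ball x R" for w
  proof -
    define W where "W = (w - x) / (y - x)"
    have wx: "w - x = W * (y - x)" using \<open>x \<noteq> y\<close> by (simp add: W_def)
    have "x + Re W *\<^sub>R (y - x) = (1 - Re W) *\<^sub>R x + Re W *\<^sub>R y" by (simp add: algebra_simps)
    then have "x + Re W *\<^sub>R (y - x) \<in> L" unfolding L_def affine_hull_2 by force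
    then have "infdist w L \<le> dist w (x + Re W *\<^sub>R (y - x))" by (rule infdist_le)
    also have "w - (x + Re W *\<^sub>R (y - x)) = (\<i> * of_real (Im W)) * (y - x)"
    proof -
      have "W = of_real (Re W) + \<i> * of_real (Im W)" by (rule complex_eq)
      then show ?thesis using wx by (metis add_diff_cancel_left' diff_diff_eq distrib_right scaleR_conv_of_real)
    qed
    then have "dist w (x + Re W *\<^sub>R (y - x)) = \<bar>Im W\<bar> * R"
      using y by (simp add: dist_norm norm_mult norm_minus_commute)
    also have "\<dots> \<le> 77760 * \<epsilon> * R"
      using small_height[of x y w] assms y w unfolding W_def by (intro mult_right_mono) auto
    finally show ?thesis .
  qed
  then have hL: "?height L \<le> 77760 * \<epsilon> * R"
    using assms by (intro cSUP_least) auto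
  \<comment> \<open>The infimum is over a real-valued family, so it is a lower bound only because the family is
    bounded below, which in turn needs each supremum to be over a bounded set.\<close>
  have "0 \<le> ?height M" if "M \<in> ?lines" for M
  proof -
    obtain a where a: "a \<in> M" "dist x a < R" using \<open>M \<in> ?lines\<close> by auto
    have "infdist u M \<le> 2 * R" if "u \<in> G \<inter> ball x R" for u
      using infdist_le[OF a(1), of u] dist_triangle[of u a x] a that by (simp add: dist_commute)
    then have "bdd_above ((\<lambda>u. infdist u M) ` (G \<inter> ball x R))"
      by (intro bdd_aboveI2)
    then have "infdist x M \<le> ?height M" using assms by (intro cSUP_upper) auto
    then show ?thesis using infdist_nonneg[of x M] by linarith
  qed
  then have "bdd_below (?height ` ?lines)" by (intro bdd_belowI2)
  moreover have "L \<in> ?lines"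
    using \<open>x \<in> L\<close> \<open>x \<noteq> y\<close> assms by (auto simp: L_def aff_dim_affine_hull)
  ultimately have "(INF L \<in> ?lines. ?height L) \<le> ?height L" by (intro cINF_lower)
  then have "(INF L \<in> ?lines. ?height L) \<le> 77760 * \<epsilon> * R" using hL by linarith
  then show ?thesis unfolding jones_beta_def using assms by (simp add: field_simps)
qed

end

section \<open>Boundaries with small Carleson function\<close>

lemma sphere_point_rcis:
  assumes "dist x p = r"
  obtains t where "c \<le> t" "t < c + 2 * pi" "p = x + rcis r t"
proof -
  define a where "a = Arg (p - x)"
  define k where "k = \<lfloor>(a - c) / (2 * pi)\<rfloor>"
  define t where "t = a + 2 * pi * of_int (- k)"
  have "of_int k \<le> (a - c) / (2 * pi)" "(a - c) / (2 * pi) < of_int k + 1"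
    unfolding k_def by linarith+
  then have "c \<le> t" "t < c + 2 * pi" by (auto simp: t_def field_simps)
  moreover have "rcis r t = p - x"
    using assms rcis_cmod_Arg[of "p - x"]
    unfolding t_def rcis_shift a_def by (simp add: dist_norm norm_minus_commute)
  ultimately show ?thesis using that[of t] by simp
qed

lemma frontier_in_arc:
  assumes "s \<le> t" "x + rcis r s \<in> D \<longleftrightarrow> x + rcis r t \<notin> D"
  obtains u where "s \<le> u" "u \<le> t" "x + rcis r u \<in> frontier D"
proof -
  let ?S = "(\<lambda>u. x + rcis r u) ` {s..t}"
  have "connected ?S"
    unfolding rcis_def cis_conv_exp
    by (intro connected_continuous_image continuous_intros) auto
  moreover have "x + rcis r s \<in> ?S" "x + rcis r t \<in> ?S" using assms by auto
  ultimately have "?S \<inter> frontier D \<noteq> {}"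
    using assms(2) by (intro connected_Int_frontier) blast+
  then show ?thesis using that by auto
qed

text \<open>Place the arc in \<open>D\<close> over \<open>(a, b)\<close> and the arc in the exterior over \<open>(a', b')\<close> with
  \<open>a \<le> a' < a + 2 * pi\<close>. Being disjoint, they satisfy \<open>b \<le> a'\<close> and \<open>b' \<le> a + 2 * pi\<close>. Both angles are at
  least \<open>pi - \<delta>\<close>, so the gaps \<open>[b, a']\<close> and \<open>[b', a + 2 * pi]\<close> have angle at most \<open>2 * \<delta>\<close>; the first
  contains the angle \<open>b\<close> and the second lies within \<open>\<delta>\<close> of \<open>b + pi\<close>. All frontier points on the
  circle lie in the gaps, and each gap contains one since it leads from \<open>D\<close> to the exterior.\<close>

lemma frontier_on_circle_antipodal_clusters:
  assumes "open D" "0 < r" "0 \<le> \<delta>" "\<delta> \<le> 1"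
    and plus: "(pi - \<delta>) * r \<le> enn2real (hausdorff1 (largest_arc D x r))"
    and minus: "(pi - \<delta>) * r \<le> enn2real (hausdorff1 (largest_arc (- closure D) x r))"
  obtains v where
    "\<And>p. p \<in> frontier D \<Longrightarrow> dist x p = r \<Longrightarrow> dist p (x + v) \<le> 2 * \<delta> * r \<or> dist p (x - v) \<le> 2 * \<delta> * r"
    "\<exists>p\<in>frontier D. dist x p = r \<and> dist p (x + v) \<le> 2 * \<delta> * r"
    "\<exists>p\<in>frontier D. dist x p = r \<and> dist p (x - v) \<le> 2 * \<delta> * r"
proof -
  let ?c = "\<lambda>t. x + rcis r t"
  have pi: "\<delta> < pi" using pi_gt3 assms by linarith
  have period: "?c (t + 2 * pi) = ?c t" for t using rcis_shift[of r t 1] by simp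
  obtain a b where ab: "a \<le> b" "b \<le> a + 2 * pi" "pi - \<delta> \<le> b - a"
    "\<And>t. a < t \<Longrightarrow> t < b \<Longrightarrow> ?c t \<in> D"
    using large_largest_arc[OF assms(2) plus] by blast
  obtain a' b' where ab': "a \<le> a'" "a' < a + 2 * pi" "a' \<le> b'" "b' \<le> a' + 2 * pi" "pi - \<delta> \<le> b' - a'"
    "\<And>t. a' < t \<Longrightarrow> t < b' \<Longrightarrow> ?c t \<in> - closure D"
    using large_largest_arc[OF assms(2) minus, of a] by blast
  have outside: "?c t \<notin> D" if "a' < t" "t < b'" for t
    using ab'(6)[OF that] closure_subset by blast
  have inside: "?c t \<in> D" if "a + 2 * pi < t" "t < b + 2 * pi" for t
    using ab(4)[of "t - 2 * pi"] period[of "t - 2 * pi"] that by simp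
  have "b \<le> a'"
  proof (rule ccontr)
    assume "\<not> b \<le> a'"
    then have "a' < min b b'" using ab' pi by auto
    then obtain t where "a' < t" "t < min b b'" using dense by blast
    then show False using ab(4)[of t] outside[of t] ab'(1) by auto
  qed
  have "b' \<le> a + 2 * pi"
  proof (rule ccontr)
    assume "\<not> b' \<le> a + 2 * pi"
    then have "a + 2 * pi < min b' (b + 2 * pi)" using ab pi by auto
    then obtain t where "a + 2 * pi < t" "t < min b' (b + 2 * pi)" using dense by blast
    then show False using inside[of t] outside[of t] ab'(2) by auto
  qed
  have "a < b" "a' < b'" using ab ab' pi by linarith+
  then obtain m m' where m: "a < m" "m < b" "a' < m'" "m' < b'" using dense[of a b] dense[of a' b'] by blast
  have frontier_iff: "frontier D \<inter> D = {}" "frontier D \<inter> - closure D = {}"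
    using \<open>open D\<close> by (auto simp: frontier_def interior_open)
  define v where "v = rcis r b"
  have cv: "x + v = ?c b" "x - v = ?c (b + pi)"
    by (simp_all add: v_def rcis_def minus_cis[symmetric])
  have first: "dist (?c t) (x + v) \<le> 2 * \<delta> * r" if "b \<le> t" "t \<le> a'" for t
  proof -
    have "\<bar>t - b\<bar> \<le> 2 * \<delta>" using that ab ab' \<open>b' \<le> a + 2 * pi\<close> by linarith
    then have "r * \<bar>t - b\<bar> \<le> r * (2 * \<delta>)" using assms by (intro mult_left_mono) auto
    then show ?thesis
      unfolding cv using dist_rcis_le[of r x t b] assms(2) by (simp only: mult.commute) linarith
  qed
  have second: "dist (?c t) (x - v) \<le> 2 * \<delta> * r" if "b' \<le> t" "t \<le> a + 2 * pi" for t
  proof -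
    have "\<bar>t - (b + pi)\<bar> \<le> 2 * \<delta>" using that ab ab' \<open>b \<le> a'\<close> assms by linarith
    then have "r * \<bar>t - (b + pi)\<bar> \<le> r * (2 * \<delta>)" using assms by (intro mult_left_mono) auto
    then show ?thesis
      unfolding cv using dist_rcis_le[of r x t "b + pi"] assms(2) by (simp only: mult.commute) linarith
  qed
  have off: "\<not> (a < t \<and> t < b)" "\<not> (a' < t \<and> t < b')" "\<not> (a + 2 * pi < t \<and> t < b + 2 * pi)"
    if "?c t \<in> frontier D" for t
    using that ab(4)[of t] ab'(6)[of t] inside[of t] frontier_iff by blast+
  have on: "dist x (?c t) = r" for t using assms by (simp add: dist_norm)
  show ?thesis
  proof (rule that[of v])
    fix p assume p: "p \<in> frontier D" "dist x p = r"
    obtain t where t: "b \<le> t" "t < b + 2 * pi" "p = ?c t" using sphere_point_rcis[OF p(2)] by blast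
    then show "dist p (x + v) \<le> 2 * \<delta> * r \<or> dist p (x - v) \<le> 2 * \<delta> * r"
      using off[of t] p first[of t] second[of t] by force
  next
    obtain u where u: "m \<le> u" "u \<le> m'" "?c u \<in> frontier D"
    proof (rule frontier_in_arc[of m m' x r D])
      show "m \<le> m'" using m \<open>b \<le> a'\<close> by linarith
      show "?c m \<in> D \<longleftrightarrow> ?c m' \<notin> D" using ab(4)[of m] outside[of m'] m by simp
    qed
    then have "b \<le> u" "u \<le> a'" using off(1,2)[of u] m by linarith+
    then show "\<exists>p\<in>frontier D. dist x p = r \<and> dist p (x + v) \<le> 2 * \<delta> * r"
      using u(3) on first by blast
  next
    obtain u where u: "m' \<le> u" "u \<le> m + 2 * pi" "?c u \<in> frontier D"
    proof (rule frontier_in_arc[of m' "m + 2 * pi" x r D])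
      show "m' \<le> m + 2 * pi" using m \<open>b' \<le> a + 2 * pi\<close> by linarith
      show "?c m' \<in> D \<longleftrightarrow> ?c (m + 2 * pi) \<notin> D"
        using inside[of "m + 2 * pi"] outside[of m'] m by simp
    qed
    then have "b' \<le> u" "u \<le> a + 2 * pi" using off(2,3)[of u] m by linarith+
    then show "\<exists>p\<in>frontier D. dist x p = r \<and> dist p (x - v) \<le> 2 * \<delta> * r"
      using u(3) on second by blast
  qed
qed

lemma carleson_eps_imp_near_symmetric:
  assumes "open D" "0 \<le> \<delta>" "\<delta> \<le> 1"
    and eps: "\<And>x r. x \<in> frontier D \<Longrightarrow> 0 < r \<Longrightarrow> r \<le> s \<Longrightarrow> carleson_eps D (- closure D) x r \<le> \<delta>"
  shows "near_symmetric (frontier D) (4 * \<delta>) s"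
  unfolding near_symmetric_def
proof (intro ballI impI)
  fix x p assume x: "x \<in> frontier D" and p: "p \<in> frontier D" and "0 < dist x p \<and> dist x p \<le> s"
  define r where "r = dist x p"
  have r: "0 < r" "r \<le> s" using \<open>0 < dist x p \<and> dist x p \<le> s\<close> by (auto simp: r_def)
  have "max \<bar>pi * r - enn2real (hausdorff1 (largest_arc D x r))\<bar>
            \<bar>pi * r - enn2real (hausdorff1 (largest_arc (- closure D) x r))\<bar> \<le> \<delta> * r"
    using eps[OF x r] r unfolding carleson_eps_def by (simp add: field_simps)
  then have "(pi - \<delta>) * r \<le> enn2real (hausdorff1 (largest_arc D x r))"
    "(pi - \<delta>) * r \<le> enn2real (hausdorff1 (largest_arc (- closure D) x r))"
    unfolding left_diff_distrib by linarith+
  then obtain v where v: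
    "\<And>p. p \<in> frontier D \<Longrightarrow> dist x p = r \<Longrightarrow> dist p (x + v) \<le> 2 * \<delta> * r \<or> dist p (x - v) \<le> 2 * \<delta> * r"
    "\<exists>p\<in>frontier D. dist x p = r \<and> dist p (x + v) \<le> 2 * \<delta> * r"
    "\<exists>p\<in>frontier D. dist x p = r \<and> dist p (x - v) \<le> 2 * \<delta> * r"
    using frontier_on_circle_antipodal_clusters[OF assms(1) r(1) assms(2,3)] by metis
  define d where "d = 2 * \<delta> * r"
  have opposite: "dist (p + q) (2 *\<^sub>R x) \<le> 2 * d"
    if "dist p (x + v) \<le> d" "dist q (x - v) \<le> d" for p q
  proof -
    have "(x + v) + (x - v) = 2 *\<^sub>R x" by (simp add: scaleR_2)
    then show ?thesis using dist_triangle_add[of p q "x + v" "x - v"] that by simp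
  qed
  have same: "dist p q \<le> 2 * d"
    if "dist p z \<le> d" "dist q z \<le> d" for p q z
    using that dist_triangle2[of p q z] by linarith
  have two_d: "4 * \<delta> * r = 2 * d" by (simp add: d_def)
  note v = v[folded d_def]
  have p_near: "dist p (x + v) \<le> d \<or> dist p (x - v) \<le> d" using v(1)[OF p] r_def by simp
  then have "\<exists>q\<in>frontier D. dist x q = r \<and> dist (p + q) (2 *\<^sub>R x) \<le> 2 * d"
    using v(2,3) opposite[of p] opposite[of _ p] by (metis add.commute)
  moreover have "dist p q \<le> 2 * d \<or> dist (p + q) (2 *\<^sub>R x) \<le> 2 * d"
    if "q \<in> frontier D" "dist x q = r" for q
    using p_near v(1)[OF that] same[of p _ q] opposite[of p q] opposite[of q p]
    by (metis add.commute)
  ultimately show "(\<exists>q\<in>frontier D. dist x q = dist x p \<and> dist (p + q) (2 *\<^sub>R x) \<le> 4 * \<delta> * dist x p) \<and>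
        (\<forall>q\<in>frontier D. dist x q = dist x p \<longrightarrow>
           dist p q \<le> 4 * \<delta> * dist x p \<or> dist (p + q) (2 *\<^sub>R x) \<le> 4 * \<delta> * dist x p)"
    unfolding r_def[symmetric] two_d by blast
qed

lemma jordan_curve_path_connected: "jordan_curve J \<Longrightarrow> path_connected J"
  unfolding jordan_curve_def by (auto intro: path_connected_path_image simple_path_imp_path)

lemma jordan_curve_two_points:
  assumes "jordan_curve J"
  obtains a b where "a \<in> J" "b \<in> J" "a \<noteq> b"
proof -
  obtain c where c: "simple_path c" "path_image c = J" using assms unfolding jordan_curve_def by blast
  have "\<forall>x\<in>{0..1}. \<forall>y\<in>{0..1}. c x = c y \<longrightarrow> x = y \<or> x = 0 \<and> y = 1 \<or> x = 1 \<and> y = 0"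
    using c(1) unfolding simple_path_def loop_free_def by blast
  from this[rule_format, of 0 "1/2"] have "c 0 \<noteq> c (1/2)" by auto
  moreover have "c 0 \<in> J" "c (1/2) \<in> J" using c(2) unfolding path_image_def by auto
  ultimately show ?thesis using that by blast
qed

theorem lemma2:
  fixes \<Omega>p \<Omega>m \<Gamma> :: "complex set" and \<alpha> C\<^sub>0 r\<^sub>0 :: real
  assumes "jordan_domain \<Omega>p"
    and "\<Omega>m = - closure \<Omega>p"
    and "\<Gamma> = frontier \<Omega>p"
    and "0 < \<alpha>" "\<alpha> < 1"
    and "0 < C\<^sub>0"
    and "0 < r\<^sub>0"
    and "\<And>x r. x \<in> \<Gamma> \<Longrightarrow> 0 < r \<Longrightarrow> r \<le> r\<^sub>0 \<Longrightarrow> carleson_eps \<Omega>p \<Omega>m x r \<le> C\<^sub>0 * r powr \<alpha>"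
  shows "\<exists>\<rho>\<^sub>1 C. 0 < \<rho>\<^sub>1 \<and> \<rho>\<^sub>1 \<le> r\<^sub>0 \<and> 0 < C \<and>
           (\<forall>x\<^sub>0\<in>\<Gamma>. \<forall>r. 0 < r \<and> r \<le> \<rho>\<^sub>1 \<longrightarrow> jones_beta \<Gamma> x\<^sub>0 r \<le> C * r powr (\<alpha> / 16))"
proof -
  have "open \<Omega>p" and J: "jordan_curve \<Gamma>" using assms unfolding jordan_domain_def by auto
  obtain a b where ab: "a \<in> \<Gamma>" "b \<in> \<Gamma>" "a \<noteq> b" using jordan_curve_two_points[OF J] .
  define \<rho> where "\<rho> = Min {1, r\<^sub>0 / 4, dist a b / 2, (1 / (144 * C\<^sub>0)) powr (1 / \<alpha>)}"
  have \<rho>: "0 < \<rho>" "\<rho> \<le> 1" "\<rho> \<le> r\<^sub>0 / 4" "\<rho> \<le> dist a b / 2" "\<rho> \<le> (1 / (144 * C\<^sub>0)) powr (1 / \<alpha>)"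
    using assms ab by (auto simp: \<rho>_def)
  \<comment> \<open>The last term of the minimum makes \<open>4 * \<delta> \<le> 1/9\<close> below, and the third one guarantees that \<open>\<Gamma>\<close>
    has points outside each ball of radius \<open>\<rho>\<close>. The factor \<open>4\<close> in the radius \<open>4 * R\<close> is the one
    required by \<open>small_height\<close>, and \<open>1244160 = 77760 * 4 * 4\<close>.\<close>
  have "jones_beta \<Gamma> x R \<le> 1244160 * C\<^sub>0 * R powr (\<alpha> / 16)"
    if x: "x \<in> \<Gamma>" and R: "0 < R" "R \<le> \<rho>" for x R
  proof -
    define \<delta> where "\<delta> = C\<^sub>0 * (4 * R) powr \<alpha>"
    have "0 < \<delta>" using assms R by (simp add: \<delta>_def)
    have "(4::real) powr \<alpha> \<le> 4 powr 1" using assms by (intro powr_mono) auto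
    then have "C\<^sub>0 * (4 powr \<alpha> * R powr \<alpha>) \<le> C\<^sub>0 * (4 * R powr \<alpha>)"
      using assms by (intro mult_left_mono mult_right_mono) auto
    then have \<delta>_le: "\<delta> \<le> 4 * C\<^sub>0 * R powr \<alpha>"
      using R by (simp add: \<delta>_def powr_mult)
    have "R powr \<alpha> \<le> ((1 / (144 * C\<^sub>0)) powr (1 / \<alpha>)) powr \<alpha>"
      using R \<rho> assms by (intro powr_mono2) auto
    also have "\<dots> = 1 / (144 * C\<^sub>0)" using assms by (simp add: powr_powr)
    finally have "4 * C\<^sub>0 * R powr \<alpha> \<le> 1/36" using assms by (simp add: field_simps)
    then have \<delta>_small: "4 * \<delta> \<le> 1/9" using \<delta>_le by linarith
    have "carleson_eps \<Omega>p (- closure \<Omega>p) z t \<le> \<delta>"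
      if "z \<in> frontier \<Omega>p" "0 < t" "t \<le> 4 * R" for z t
    proof -
      have "carleson_eps \<Omega>p (- closure \<Omega>p) z t \<le> C\<^sub>0 * t powr \<alpha>"
        using assms(8)[of z t] that R \<rho> assms(2,3) by auto
      also have "\<dots> \<le> \<delta>"
        unfolding \<delta>_def using that assms by (intro mult_left_mono powr_mono2) auto
      finally show ?thesis .
    qed
    then have "near_symmetric \<Gamma> (4 * \<delta>) (4 * R)"
      unfolding assms(3) using \<open>open \<Omega>p\<close> \<open>0 < \<delta>\<close> \<delta>_small
      by (intro carleson_eps_imp_near_symmetric) auto
    then interpret near_symmetric_set \<Gamma> "4 * \<delta>" "4 * R"
      using jordan_curve_path_connected[OF J] \<open>0 < \<delta>\<close> \<delta>_small by unfold_locales auto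
    have "R \<le> dist x a \<or> R \<le> dist x b"
      using R \<rho> dist_triangle[of a b x] by (auto simp: dist_commute)
    then have "jones_beta \<Gamma> x R \<le> 77760 * (4 * \<delta>)"
      using jones_beta_le[OF x] ab R by blast
    also have "\<dots> \<le> 1244160 * C\<^sub>0 * R powr \<alpha>" using \<delta>_le by simp
    also have "\<dots> \<le> 1244160 * C\<^sub>0 * R powr (\<alpha> / 16)"
      using assms R \<rho> by (intro mult_left_mono powr_mono') auto
    finally show ?thesis .
  qed
  moreover have "\<rho> \<le> r\<^sub>0" "0 < 1244160 * C\<^sub>0" using \<rho> assms by auto
  ultimately show ?thesis using \<rho>(1) by blast
qed

end
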